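(* Let $n_x,n_\omega,N,K,m,r$ be positive integers, $\alpha\in(0,1)$, $\theta>0$, $c\in\mathbb{R}^{n_x}$, $A\in\mathbb{R}^{m\times n_x}$, $b\in\mathbb{R}^m$, and let $d_k\in\mathbb{R}^{n_x}$, $e_k\in\mathbb{R}^{n_\omega}$, $f_k\in\mathbb{R}$ for $k\in\{1,\dots,K\}$. Put $$Z(x,\omega):=\max_{1\le k\le K}\left(d_k^\top x+e_k^\top\omega-f_k\right).$$ Let $\Omega:=\{\omega\in\mathbb{R}^{n_\omega}\mid G\omega\le h\}$ with $G\in\mathbb{R}^{r\times n_\omega}$, $h\in\mathbb{R}^r$, let $\widehat\omega_1,\dots,\widehat\omega_N\in\Omega$, and let $\mathcal{M}_N^\theta$ be the Wasserstein ambiguity set of radius $\theta$ on $\Omega$ around the empirical distribution of $\widehat\omega_1,\dots,\widehat\omega_N$. Then the distributionally robust CVaR-constrained program $$\min_{x\in\mathbb{R}^{n_x}} c^\top x\quad\text{s.t.}\quad Ax\le b,\qquad \sup_{\mathbb{P}\in\mathcal{M}_N^\theta}\ \inf_{t\in\mathbb{R}}\left[\frac1\alpha\,\mathbb{E}_{\mathbb{P}}\big[(Z(x,\omega)+t)_+\big]-t\right]\le 0$$ is equivalent to the finite-dimensional program $$\begin{aligned} \min_{x,\lambda,t,s,\eta}\quad & c^\top x\\ \text{s.t.}\quad & Ax\le b,\\ & \lambda\theta+\frac1N\sum_{i=1}^N s_i\le t\alpha,\\ & d_k^\top x-f_k+t+(e_k-G^\top\eta_{ik})^\top\widehat\omega_i+\eta_{ik}^\top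 h\le s_i,\\ & \|e_k-G^\top\eta_{ik}\|\le\lambda,\quad \eta_{ik}\ge 0,\\ & t\in\mathbb{R},\quad \lambda\ge 0,\quad s_i\ge 0, \end{aligned}$$ where the constraints involving $s_i$ and $\eta_{ik}\in\mathbb{R}^r$ are imposed for every $i\in\{1,\dots,N\}$ and $k\in\{1,\dots,K\}$. Equivalence means that the two programs have the same objective $c^\top x$ and that $x$ is feasible for the first program if and only if there exist $\lambda,t,s=(s_i)_i,\eta=(\eta_{ik})_{i,k}$ such that $(x,\lambda,t,s,\eta)$ is feasible for the second.
   Context: Notation: $(u)_+:=\max\{u,0\}$; vector inequalities are componentwise; $\|\cdot\|$ is the Euclidean norm. Let $\mathcal{P}_1(\Omega)$ be the set of Borel probability measures supported on $\Omega$ with finite first moment. For $\mu,\nu\in\mathcal{P}_1(\Omega)$ the (type-1) Wasserstein distance is $W_1(\mu,\nu):=\inf_{\gamma}\int_{\Omega\times\Omega}\|\omega-\omega'\|\,\gamma(d\omega,d\omega')$, the infimum being over all couplings $\gamma$ of $\mu$ and $\nu$ (probability measures on $\Omega\times\Omega$ with marginals $\mu$ and $\nu$). The empirical distribution is $\widehat{\mathbb{P}}_N:=\frac1N\sum_{i=1}^N\delta_{\widehat\omega_i}$, where $\delta_{\widehat\omega_i}$ is the unit point mass at $\widehat\omega_i$. The Wasserstein ambiguity set is $$\mathcal{M}_N^\theta:=\{\mu\in\mathcal{P}_1(\Omega)\mid W_1(\mu,\widehat{\mathbb{P}}_N)\le\theta\}.$$ In $\mathbb{E}_{\mathbb{P}}$,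 the random vector $\omega$ has distribution $\mathbb{P}$. *)

theory Defs
  imports "HOL-Probability.Probability"
begin

section \<open>Wasserstein ambiguity sets\<close>

text \<open>
  Probability measures on \<open>\<Omega>\<close> are represented as Borel measures on the ambient space
  that are concentrated on \<open>\<Omega>\<close>.
\<close>

definition prob_measures1 :: "'a::euclidean_space set \<Rightarrow> 'a measure set" where
  "prob_measures1 \<Omega> =
    {\<mu>. prob_space \<mu> \<and> sets \<mu> = sets borel \<and> (AE \<omega> in \<mu>. \<omega> \<in> \<Omega>) \<and>
        integrable \<mu> (\<lambda>\<omega>. norm \<omega>)}"

definition couplings ::
  "'a::euclidean_space set \<Rightarrow> 'a measure \<Rightarrow> 'a measure \<Rightarrow> ('a \<times> 'a) measure set" where
  "couplings \<Omega> \<mu> \<nu> =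
    {\<gamma>. prob_space \<gamma> \<and> sets \<gamma> = sets (borel \<Otimes>\<^sub>M borel) \<and> (AE z in \<gamma>. z \<in> \<Omega> \<times> \<Omega>) \<and>
        distr \<gamma> borel fst = \<mu> \<and> distr \<gamma> borel snd = \<nu>}"

definition wasserstein1 ::
  "'a::euclidean_space set \<Rightarrow> 'a measure \<Rightarrow> 'a measure \<Rightarrow> ennreal" where
  "wasserstein1 \<Omega> \<mu> \<nu> =
    (INF \<gamma>\<in>couplings \<Omega> \<mu> \<nu>. \<integral>\<^sup>+z\<in>(\<Omega> \<times> \<Omega>). ennreal (norm (fst z - snd z)) \<partial>\<gamma>)"

text \<open>The samples are indexed by a finite type, so that \<open>N = CARD('n)\<close>.\<close>

definition empirical :: "('n::finite \<Rightarrow> 'a::euclidean_space) \<Rightarrow> 'a measure" where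
  "empirical \<omega>h =
    measure_of UNIV (sets borel)
      (\<lambda>B. ennreal (1 / real CARD('n)) * (\<Sum>i\<in>UNIV. emeasure (return borel (\<omega>h i)) B))"

text \<open>
  \<^const>\<open>measure_of\<close> yields the null measure if its argument is not countably additive;
  the following fact excludes this.
\<close>

lemma emeasure_empirical:
  fixes \<omega>h :: "'n::finite \<Rightarrow> 'a::euclidean_space"
  assumes "B \<in> sets borel"
  shows "emeasure (empirical \<omega>h) B =
    ennreal (1 / real CARD('n)) * (\<Sum>i\<in>UNIV. emeasure (return borel (\<omega>h i)) B)"
proof (rule emeasure_measure_of[OF empirical_def])
  show "sets borel \<subseteq> Pow (UNIV :: 'a set)" by simp
  show "B \<in> sets (empirical \<omega>h)"
    using assms by (simp add: empirical_def sets.sigma_sets_eq[of borel, simplified])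
  show "positive (sets (empirical \<omega>h))
     (\<lambda>B. ennreal (1 / real CARD('n)) * (\<Sum>i\<in>UNIV. emeasure (return borel (\<omega>h i)) B))"
    by (simp add: positive_def)
  show "countably_additive (sets (empirical \<omega>h))
     (\<lambda>B. ennreal (1 / real CARD('n)) * (\<Sum>i\<in>UNIV. emeasure (return borel (\<omega>h i)) B))"
  proof (rule countably_additiveI)
    fix F :: "nat \<Rightarrow> 'a set"
    assume F: "range F \<subseteq> sets (empirical \<omega>h)" and d: "disjoint_family F"
    have F': "range F \<subseteq> sets borel"
      using F by (simp add: empirical_def sets.sigma_sets_eq[of borel, simplified])
    have "(\<Sum>j. \<Sum>i\<in>UNIV. emeasure (return borel (\<omega>h i)) (F j)) =
        (\<Sum>i\<in>UNIV. \<Sum>j. emeasure (return borel (\<omega>h i)) (F j))"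
      by (rule suminf_sum) simp
    also have "\<dots> = (\<Sum>i\<in>UNIV. emeasure (return borel (\<omega>h i)) (\<Union>j. F j))"
      using F' d by (intro sum.cong refl suminf_emeasure) simp_all
    finally show "(\<Sum>j. ennreal (1 / real CARD('n)) *
          (\<Sum>i\<in>UNIV. emeasure (return borel (\<omega>h i)) (F j))) =
        ennreal (1 / real CARD('n)) *
          (\<Sum>i\<in>UNIV. emeasure (return borel (\<omega>h i)) (\<Union>j. F j))"
      by (simp only: ennreal_suminf_cmult)
  qed
qed

definition ambiguity_set ::
  "'a::euclidean_space set \<Rightarrow> real \<Rightarrow> ('n::finite \<Rightarrow> 'a) \<Rightarrow> 'a measure set" where
  "ambiguity_set \<Omega> \<theta> \<omega>h =
    {\<mu> \<in> prob_measures1 \<Omega>. wasserstein1 \<Omega> \<mu> (empirical \<omega>h) \<le> ennreal \<theta>}"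


section \<open>The two programs\<close>

text \<open>The order on vectors is componentwise (\<open>less_eq_vec_def\<close>).\<close>

definition polyhedron_le :: "real^'w^'r \<Rightarrow> real^'r \<Rightarrow> (real^'w) set" where
  "polyhedron_le G h = {\<omega>. G *v \<omega> \<le> h}"

definition Zmax ::
  "('k::finite \<Rightarrow> real^'x) \<Rightarrow> ('k \<Rightarrow> real^'w) \<Rightarrow> ('k \<Rightarrow> real) \<Rightarrow> real^'x \<Rightarrow> real^'w \<Rightarrow> real" where
  "Zmax d e f x \<omega> = Max (range (\<lambda>k. d k \<bullet> x + e k \<bullet> \<omega> - f k))"

text \<open>
  Infimum and supremum are taken in \<^typ>\<open>ereal\<close>, so no boundedness is built in.  The
  expectation is a Bochner integral; its integrand has linear growth in \<open>\<omega>\<close>, hence is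
  integrable for every measure with finite first moment.
\<close>

definition cvar_inf :: "real \<Rightarrow> 'a measure \<Rightarrow> ('a \<Rightarrow> real) \<Rightarrow> ereal" where
  "cvar_inf \<alpha> P Y =
    (INF t. ereal (1 / \<alpha> * (\<integral>\<omega>. max (Y \<omega> + t) 0 \<partial>P) - t))"

definition dr_objective :: "real^'x \<Rightarrow> real^'x \<Rightarrow> real" where
  "dr_objective c x = c \<bullet> x"

definition dr_feasible ::
  "real^'x^'m \<Rightarrow> real^'m \<Rightarrow> ('k::finite \<Rightarrow> real^'x) \<Rightarrow> ('k \<Rightarrow> real^'w) \<Rightarrow> ('k \<Rightarrow> real) \<Rightarrow>
   real^'w^'r \<Rightarrow> real^'r \<Rightarrow> real \<Rightarrow> real \<Rightarrow> ('n::finite \<Rightarrow> real^'w) \<Rightarrow> (real^'x) set" where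
  "dr_feasible A b d e f G h \<alpha> \<theta> \<omega>h =
    {x. A *v x \<le> b \<and>
        (SUP P\<in>ambiguity_set (polyhedron_le G h) \<theta> \<omega>h. cvar_inf \<alpha> P (Zmax d e f x)) \<le> 0}"

definition fin_objective ::
  "real^'x \<Rightarrow> (real^'x) \<times> real \<times> real \<times> (real^'n) \<times> ('n \<Rightarrow> 'k \<Rightarrow> real^'r) \<Rightarrow> real" where
  "fin_objective c = (\<lambda>(x, l, t, s, \<eta>). c \<bullet> x)"

definition fin_feasible ::
  "real^'x^'m \<Rightarrow> real^'m \<Rightarrow> ('k::finite \<Rightarrow> real^'x) \<Rightarrow> ('k \<Rightarrow> real^'w) \<Rightarrow> ('k \<Rightarrow> real) \<Rightarrow>
   real^'w^'r \<Rightarrow> real^'r \<Rightarrow> real \<Rightarrow> real \<Rightarrow> ('n::finite \<Rightarrow> real^'w) \<Rightarrow>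
   ((real^'x) \<times> real \<times> real \<times> (real^'n) \<times> ('n \<Rightarrow> 'k \<Rightarrow> real^'r)) set" where
  "fin_feasible A b d e f G h \<alpha> \<theta> \<omega>h =
    {(x, l, t, s, \<eta>).
        A *v x \<le> b \<and>
        l * \<theta> + 1 / real CARD('n) * (\<Sum>i\<in>UNIV. s $ i) \<le> t * \<alpha> \<and>
        (\<forall>i k. d k \<bullet> x - f k + t + (e k - transpose G *v \<eta> i k) \<bullet> \<omega>h i + \<eta> i k \<bullet> h \<le> s $ i) \<and>
        (\<forall>i k. norm (e k - transpose G *v \<eta> i k) \<le> l \<and> \<eta> i k \<ge> 0) \<and>
        l \<ge> 0 \<and> (\<forall>i. s $ i \<ge> 0)}"

end

(*
  Feasible for the finite program implies feasible for the robust one: the constraints force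
  (Z(x,w) + t)_+ <= s_i + lambda |w - w_i| for all w in Omega and all i, and integrating this
  against a nearly optimal coupling bounds the expectation by lambda theta + (1/N) sum s_i.

  Conversely, for fixed x the requirement on (lambda, t, s) is a system of linear inequalities
  indexed by the points w of Omega.  Those at the sample points alone, with the budget, already
  confine (lambda, t, s) to a compact set, because theta > 0 and 0 < alpha < 1, so if the whole
  system is infeasible then so is a finite subsystem.  The Farkas multipliers of that subsystem,
  normalised by the multiplier of the budget constraint, are the weights of a discrete measure P
  in the ambiguity set: the coefficients of s, lambda and t give the marginal on the samples, the
  transport cost and the mass alpha of the tail.  The CVaR of Z(x, .) under P is positive, and no
  minimax theorem is needed since the lower bound holds for every t with the same P.  Finally
  eta_ik is obtained from the separation of a finitely generated, hence closed, cone from a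
  compact convex set.
*)
theory Submission
  imports Defs
begin

section \<open>Theorems of the alternative\<close>

text \<open>The nonnegative combinations form a convex cone containing the generators, so the hull
  lies inside it. The multipliers are indexed by \<open>I\<close> and not by the points
  \<open>g i\<close>, so each stays attached to its constraint even if generators coincide.\<close>

lemma convex_cone_hull_image_subset:
  fixes g :: "'i \<Rightarrow> 'v::real_vector"
  assumes "finite I"
  shows "convex_cone hull (g ` I) \<subseteq> {y. \<exists>p. (\<forall>i\<in>I. 0 \<le> p i) \<and> y = (\<Sum>i\<in>I. p i *\<^sub>R g i)}"
    (is "_ \<subseteq> ?C")
proof (rule hull_minimal)
  show "g ` I \<subseteq> ?C"
  proof
    fix y assume "y \<in> g ` I"
    then obtain j where j: "j \<in> I" "y = g j" by auto
    have "y = (\<Sum>i\<in>I. (if i = j then 1 else 0) *\<^sub>R g i)"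
      using j assms by (simp add: if_distrib[where f = "\<lambda>c. c *\<^sub>R _"] sum.delta cong: if_cong)
    then show "y \<in> ?C"
      by (intro CollectI exI[of _ "\<lambda>i. if i = j then 1 else (0::real)"]) auto
  qed
  show "convex_cone ?C"
    unfolding convex_cone_iff
  proof (intro conjI ballI allI impI)
    show "0 \<in> ?C" by (auto intro!: exI[of _ "\<lambda>_. 0"])
  next
    fix x y assume "x \<in> ?C" "y \<in> ?C"
    then obtain p q where "\<forall>i\<in>I. 0 \<le> p i" "x = (\<Sum>i\<in>I. p i *\<^sub>R g i)"
      "\<forall>i\<in>I. 0 \<le> q i" "y = (\<Sum>i\<in>I. q i *\<^sub>R g i)" by auto
    then show "x + y \<in> ?C"
      by (auto intro!: exI[of _ "\<lambda>i. p i + q i"] simp: scaleR_add_left sum.distrib)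
  next
    fix x and c :: real assume "x \<in> ?C" "0 \<le> c"
    then obtain p where "\<forall>i\<in>I. 0 \<le> p i" "x = (\<Sum>i\<in>I. p i *\<^sub>R g i)" by auto
    with \<open>0 \<le> c\<close> show "c *\<^sub>R x \<in> ?C"
      by (auto intro!: exI[of _ "\<lambda>i. c * p i"] simp: scaleR_sum_right)
  qed
qed

text \<open>A strictly separating hyperplane has a level \<open>b\<close>, and \<open>b < 0\<close>
  because the cone contains 0. Invariance of the cone under scaling then raises its lower bound from
  \<open>b\<close> to 0.\<close>

lemma separating_closed_convex_cone_compact:
  fixes C :: "'v::euclidean_space set"
  assumes C: "convex_cone C" "closed C" and T: "convex T" "compact T" "T \<noteq> {}"
    and disj: "C \<inter> T = {}"
  obtains v where "\<And>x. x \<in> C \<Longrightarrow> 0 \<le> v \<bullet> x" "\<And>z. z \<in> T \<Longrightarrow> v \<bullet> z < 0"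
proof -
  have "convex C" using C by (simp add: convex_cone_def)
  then obtain v b where vb: "\<forall>x\<in>T. v \<bullet> x < b" "\<forall>x\<in>C. b < v \<bullet> x"
    using separating_hyperplane_compact_closed[of T C] C T disj by auto
  have "b < 0" using vb(2) convex_cone_contains_0[OF C(1)] by fastforce
  show ?thesis
  proof (rule that)
    show "v \<bullet> z < 0" if "z \<in> T" for z using vb(1) that \<open>b < 0\<close> by force
    show "0 \<le> v \<bullet> x" if "x \<in> C" for x
    proof (rule ccontr)
      assume neg: "\<not> 0 \<le> v \<bullet> x"
      \<comment> \<open>This multiple of \<open>x\<close> has inner product exactly \<open>b\<close>
        with \<open>v\<close>, against the strict bound on \<open>C\<close>.\<close>
      have "(b / (v \<bullet> x)) *\<^sub>R x \<in> C"
        using C(1) that neg \<open>b < 0\<close> by (intro convex_cone_scaleR) (auto simp: zero_le_divide_iff)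
      then have "b < v \<bullet> ((b / (v \<bullet> x)) *\<^sub>R x)" using vb(2) by blast
      then show False using neg by simp
    qed
  qed
qed

text \<open>Homogenisation: a pair \<open>(a i, b i)\<close> stands for one inequality,
  \<open>(0, - 1)\<close> for weakening, and \<open>(0, 1)\<close> for the absurd inequality 1 \<le>
  0. If \<open>(0, 1)\<close> lies in the generated cone, its coefficients are the certificate;
  otherwise a separating vector, rescaled by its last coordinate, solves the system.\<close>

lemma farkas_finite:
  fixes a :: "'i \<Rightarrow> 'v::euclidean_space"
  assumes fin: "finite I" and infeas: "\<nexists>y. \<forall>i\<in>I. b i \<le> a i \<bullet> y"
  shows "\<exists>p. (\<forall>i\<in>I. 0 \<le> p i) \<and> (\<Sum>i\<in>I. p i *\<^sub>R a i) = 0 \<and> (\<Sum>i\<in>I. p i * b i) > 0"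
proof -
  define g where "g = (\<lambda>j. case j of None \<Rightarrow> (0 :: 'v, - 1 :: real) | Some i \<Rightarrow> (a i, b i))"
  define J where "J = insert None (Some ` I)"
  define C where "C = convex_cone hull (g ` J)"
  have finJ: "finite J" using fin by (simp add: J_def)
  have gC: "g j \<in> C" if "j \<in> J" for j
    using that unfolding C_def by (simp add: hull_inc)
  have "(0, 1) \<in> C"
  proof (rule ccontr)
    assume "(0, 1) \<notin> C"
    then have "C \<inter> {(0, 1)} = {}" by simp
    moreover have "closed C" unfolding C_def using finJ by (intro closed_convex_cone_hull) simp
    moreover have "convex_cone C" unfolding C_def by (rule convex_cone_convex_cone_hull)
    ultimately obtain v where v: "\<And>x. x \<in> C \<Longrightarrow> 0 \<le> v \<bullet> x" "v \<bullet> (0, 1) < 0"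
      using separating_closed_convex_cone_compact[of C "{(0, 1)}"]
      by (metis (no_types, lifting) compact_sing convex_singleton insertI1 insert_not_empty)
    obtain y \<tau> where y: "v = (y, \<tau>)" by (cases v)
    have "\<tau> < 0" using v(2) by (simp add: y)
    have "b i \<le> a i \<bullet> (y /\<^sub>R (- \<tau>))" if "i \<in> I" for i
    proof -
      have "0 \<le> v \<bullet> g (Some i)" using that by (intro v(1) gC) (simp add: J_def)
      then have "0 \<le> a i \<bullet> y + \<tau> * b i" by (simp add: y g_def inner_commute)
      then have "b i \<le> (a i \<bullet> y) / (- \<tau>)"
        using \<open>\<tau> < 0\<close> by (subst pos_le_divide_eq) (simp_all add: mult.commute)
      also have "\<dots> = a i \<bullet> (y /\<^sub>R (- \<tau>))"
        by (simp only: inner_scaleR_right divide_inverse mult.commute)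
      finally show ?thesis .
    qed
    with infeas show False by blast
  qed
  then obtain p where p: "\<forall>j\<in>J. 0 \<le> p j" "(0, 1) = (\<Sum>j\<in>J. p j *\<^sub>R g j)"
    using convex_cone_hull_image_subset[OF finJ, of g] unfolding C_def by blast
  have "(\<Sum>j\<in>J. p j *\<^sub>R g j) = p None *\<^sub>R (0, - 1) + (\<Sum>i\<in>I. p (Some i) *\<^sub>R (a i, b i))"
    unfolding J_def using fin by (subst sum.insert) (auto simp: sum.reindex g_def)
  also have "\<dots> = (\<Sum>i\<in>I. p (Some i) *\<^sub>R a i, (\<Sum>i\<in>I. p (Some i) * b i) - p None)"
    by (simp add: prod_eq_iff fst_sum snd_sum)
  finally have eq: "(\<Sum>i\<in>I. p (Some i) *\<^sub>R a i) = 0" "(\<Sum>i\<in>I. p (Some i) * b i) = 1 + p None"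
    using p(2) by simp_all
  have pos: "p None \<ge> 0" "\<And>i. i \<in> I \<Longrightarrow> p (Some i) \<ge> 0"
    using p(1) by (auto simp: J_def)
  show ?thesis
    by (rule exI[of _ "\<lambda>i. p (Some i)"]) (use eq pos in auto)
qed

text \<open>The subsystem \<open>I0\<close> cuts out a compact set, so the finite intersection
  property reduces an infinite infeasible system to a finite one. Keeping \<open>I0\<close> inside
  \<open>J\<close> lets the multipliers of distinguished constraints be addressed by name
  later.\<close>

lemma farkas_bounded:
  fixes a :: "'i \<Rightarrow> 'v::euclidean_space"
  assumes infeas: "\<nexists>y. \<forall>i\<in>I. b i \<le> a i \<bullet> y"
    and base: "finite I0" "I0 \<subseteq> I" "bounded {y. \<forall>i\<in>I0. b i \<le> a i \<bullet> y}"
  shows "\<exists>J p. finite J \<and> I0 \<subseteq> J \<and> J \<subseteq> I \<and> (\<forall>i\<in>J. 0 \<le> p i) \<and>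
    (\<Sum>i\<in>J. p i *\<^sub>R a i) = 0 \<and> (\<Sum>i\<in>J. p i * b i) > 0"
proof -
  define H where "H = (\<lambda>i. {y. b i \<le> a i \<bullet> y})"
  have clH: "closed (H i)" for i
    unfolding H_def by (intro closed_Collect_le continuous_intros)
  have B: "{y. \<forall>i\<in>I0. b i \<le> a i \<bullet> y} = (\<Inter>i\<in>I0. H i)" by (auto simp: H_def)
  have "compact (\<Inter>i\<in>I0. H i)"
    using base(3) clH by (auto simp: compact_eq_bounded_closed B)
  moreover have "(\<Inter>i\<in>I0. H i) \<inter> (\<Inter>i\<in>I. H i) = {}" using infeas by (auto simp: H_def)
  ultimately obtain I' where I': "finite I'" "I' \<subseteq> I" "(\<Inter>i\<in>I0. H i) \<inter> (\<Inter>i\<in>I'. H i) = {}"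
    using compact_imp_fip_image[of "\<Inter>i\<in>I0. H i" I H] clH by blast
  have infeas': "\<nexists>y. \<forall>i\<in>I0 \<union> I'. b i \<le> a i \<bullet> y" using I'(3) by (auto simp: H_def)
  have fin: "finite (I0 \<union> I')" using I' base by simp
  obtain p where "\<forall>i\<in>I0 \<union> I'. 0 \<le> p i"
    "(\<Sum>i\<in>I0 \<union> I'. p i *\<^sub>R a i) = 0" "(\<Sum>i\<in>I0 \<union> I'. p i * b i) > 0"
    using farkas_finite[OF fin infeas'] by blast
  with fin I'(2) base(2) show ?thesis by (intro exI[of _ "I0 \<union> I'"] exI[of _ p]) auto
qed

section \<open>Duality for a norm-penalised linear function on a polyhedron\<close>

lemma matrix_vector_mult_row_nth: "(G *v x) $ i = row i G \<bullet> x" for G :: "real^'w^'r"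
  by (simp add: row_def matrix_vector_mul_component)

text \<open>The sought \<eta> is a representation of some point of the compact convex set
  \<open>T\<close> by the cone generated by the rows of the system. If cone and set were disjoint,
  the separating vector would give a point or a ray of the polyhedron violating
  \<open>bound\<close>.\<close>

lemma norm_regularized_polyhedron_duality:
  fixes G :: "real^'w^'r" and h :: "real^'r"
  assumes \<omega>0: "\<omega>0 \<in> polyhedron_le G h" and "0 \<le> l"
    and bound: "\<And>\<omega>. \<omega> \<in> polyhedron_le G h \<Longrightarrow> e \<bullet> \<omega> - l * norm (\<omega> - \<omega>0) \<le> \<sigma>"
  obtains \<eta> :: "real^'r" where "\<eta> \<ge> 0" "norm (e - transpose G *v \<eta>) \<le> l"
    "(e - transpose G *v \<eta>) \<bullet> \<omega>0 + \<eta> \<bullet> h \<le> \<sigma>"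
proof -
  \<comment> \<open>The generator \<open>(0, 1)\<close> carries the slack in the last inequality of
    the conclusion.\<close>
  define g where "g = (\<lambda>j. case j of None \<Rightarrow> (0 :: real^'w, 1 :: real) | Some i \<Rightarrow> (row i G, h $ i))"
  define C where "C = convex_cone hull (range g)"
  \<comment> \<open>Here \<open>u\<close> ranges over the admissible values of
    \<open>e - transpose G *v \<eta>\<close>; the second component is what then remains for
    \<open>\<eta> \<bullet> h\<close>.\<close>
  define T where "T = (\<lambda>u. (e - u, \<sigma> - u \<bullet> \<omega>0)) ` cball 0 l"
  have gC: "g j \<in> C" for j unfolding C_def by (simp add: hull_inc)
  have "compact T" unfolding T_def
    by (intro compact_continuous_image continuous_intros compact_cball)
  have "T = (+) (e, \<sigma>) ` ((\<lambda>u. (- u, - (u \<bullet> \<omega>0))) ` cball 0 l)"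
    unfolding T_def image_image by (intro image_cong) auto
  moreover have "linear (\<lambda>u :: real^'w. (- u, - (u \<bullet> \<omega>0)))"
    by (intro linearI) (auto simp: inner_simps)
  ultimately have "convex T"
    by (simp add: convex_linear_image convex_translation)
  have "T \<noteq> {}" using \<open>0 \<le> l\<close> by (simp add: T_def)
  have "C \<inter> T \<noteq> {}"
  proof
    assume "C \<inter> T = {}"
    moreover have "closed C" unfolding C_def by (intro closed_convex_cone_hull) simp
    moreover have "convex_cone C" unfolding C_def by (rule convex_cone_convex_cone_hull)
    ultimately obtain v where v: "\<And>x. x \<in> C \<Longrightarrow> 0 \<le> v \<bullet> x" "\<And>z. z \<in> T \<Longrightarrow> v \<bullet> z < 0"
      using separating_closed_convex_cone_compact \<open>compact T\<close> \<open>convex T\<close> \<open>T \<noteq> {}\<close> by metis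
    obtain w \<tau> where w: "v = (- w, \<tau>)" by (metis minus_minus surj_pair)
    have "\<tau> \<ge> 0" using v(1)[OF gC[of None]] by (simp add: g_def w)
    have row: "row i G \<bullet> w \<le> \<tau> * h $ i" for i
      using v(1)[OF gC[of "Some i"]] by (simp add: g_def w inner_commute)
    \<comment> \<open>This \<open>u\<close> maximises
      \<open>u \<bullet> (w - \<tau> *\<^sub>R \<omega>0)\<close> over the ball, so negativity of
      \<open>v\<close> at its point of \<open>T\<close> is the strongest case and gives
      \<open>gap\<close>.\<close>
    define u where "u = l *\<^sub>R sgn (w - \<tau> *\<^sub>R \<omega>0)"
    have "norm u \<le> l" using \<open>0 \<le> l\<close> by (simp add: u_def norm_sgn)
    then have "v \<bullet> (e - u, \<sigma> - u \<bullet> \<omega>0) < 0" by (intro v(2)) (auto simp: T_def)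
    moreover have "u \<bullet> (w - \<tau> *\<^sub>R \<omega>0) = l * norm (w - \<tau> *\<^sub>R \<omega>0)"
      by (cases "w - \<tau> *\<^sub>R \<omega>0 = 0")
        (simp_all add: u_def sgn_div_norm power2_norm_eq_inner[symmetric] power2_eq_square
          del: right_minus_eq)
    ultimately have gap: "\<tau> * \<sigma> < e \<bullet> w - l * norm (w - \<tau> *\<^sub>R \<omega>0)"
      by (simp add: w inner_simps inner_commute algebra_simps)
    \<comment> \<open>\<open>w / \<tau>\<close> is a point of the polyhedron, or \<open>w\<close> a recession direction if \<open>\<tau> = 0\<close>.\<close>
    show False
    proof (cases "\<tau> = 0")
      case True
      define \<delta> where "\<delta> = e \<bullet> w - l * norm w"
      have "\<delta> > 0" using gap True by (simp add: \<delta>_def)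
      \<comment> \<open>So far along the ray from \<omega>0 in direction \<open>w\<close>, the
        penalised function has the value \<open>\<sigma> + \<delta>\<close>.\<close>
      define M where "M = (\<sigma> - e \<bullet> \<omega>0) / \<delta> + 1"
      have "M \<ge> 0" using bound[OF \<omega>0] \<open>\<delta> > 0\<close> by (simp add: M_def)
      have "\<omega>0 + M *\<^sub>R w \<in> polyhedron_le G h"
        unfolding polyhedron_le_def less_eq_vec_def mem_Collect_eq
      proof
        fix i
        have "row i G \<bullet> \<omega>0 \<le> h $ i"
          using \<omega>0 by (simp add: polyhedron_le_def less_eq_vec_def matrix_vector_mult_row_nth)
        moreover have "M * (row i G \<bullet> w) \<le> 0"
          using row[of i] True \<open>M \<ge> 0\<close> by (simp add: mult_nonneg_nonpos)
        ultimately show "(G *v (\<omega>0 + M *\<^sub>R w)) $ i \<le> h $ i"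
          by (simp add: matrix_vector_mult_row_nth inner_add_right)
      qed
      then have "e \<bullet> (\<omega>0 + M *\<^sub>R w) - l * norm (M *\<^sub>R w) \<le> \<sigma>" using bound by fastforce
      then have "e \<bullet> \<omega>0 + M * \<delta> \<le> \<sigma>"
        using \<open>M \<ge> 0\<close> by (simp add: \<delta>_def inner_simps algebra_simps)
      moreover have "M * \<delta> = \<sigma> - e \<bullet> \<omega>0 + \<delta>"
        using \<open>\<delta> > 0\<close> by (simp add: M_def distrib_right)
      ultimately show False using \<open>\<delta> > 0\<close> by simp
    next
      case False
      with \<open>\<tau> \<ge> 0\<close> have "\<tau> > 0" by simp
      have "w /\<^sub>R \<tau> \<in> polyhedron_le G h"
        unfolding polyhedron_le_def less_eq_vec_def mem_Collect_eq
      proof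
        fix i
        show "(G *v (w /\<^sub>R \<tau>)) $ i \<le> h $ i"
          using row[of i] \<open>\<tau> > 0\<close>
          by (simp add: matrix_vector_mult_row_nth divide_simps mult.commute)
      qed
      from bound[OF this] have "\<tau> * (e \<bullet> (w /\<^sub>R \<tau>) - l * norm (w /\<^sub>R \<tau> - \<omega>0)) \<le> \<tau> * \<sigma>"
        using \<open>\<tau> > 0\<close> by simp
      moreover have "\<tau> * norm (w /\<^sub>R \<tau> - \<omega>0) = norm (w - \<tau> *\<^sub>R \<omega>0)"
        using \<open>\<tau> > 0\<close> norm_scaleR[of \<tau> "w /\<^sub>R \<tau> - \<omega>0"] by (simp add: algebra_simps)
      moreover have "\<tau> * (e \<bullet> (w /\<^sub>R \<tau>)) = e \<bullet> w" using \<open>\<tau> > 0\<close> by simp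
      ultimately have "e \<bullet> w - l * norm (w - \<tau> *\<^sub>R \<omega>0) \<le> \<tau> * \<sigma>"
        by (simp only: right_diff_distrib mult.left_commute[of \<tau> l])
      with gap show False by simp
    qed
  qed
  then obtain z where "z \<in> C" "z \<in> T" by blast
  then obtain u where z: "z \<in> C" "z = (e - u, \<sigma> - u \<bullet> \<omega>0)" "norm u \<le> l"
    unfolding T_def by auto
  then obtain p where p: "\<forall>j. 0 \<le> p j" "z = (\<Sum>j\<in>UNIV. p j *\<^sub>R g j)"
    using convex_cone_hull_image_subset[of UNIV g] unfolding C_def by auto
  define \<eta> where "\<eta> = (\<chi> i. p (Some i))"
  have "z = p None *\<^sub>R (0, 1) + (\<Sum>i\<in>UNIV. p (Some i) *\<^sub>R (row i G, h $ i))"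
    unfolding p(2) UNIV_option_conv by (subst sum.insert) (auto simp: sum.reindex g_def)
  also have "\<dots> = (transpose G *v \<eta>, p None + \<eta> \<bullet> h)"
    by (simp add: prod_eq_iff fst_sum snd_sum matrix_mult_sum \<eta>_def inner_vec_def
        scalar_mult_eq_scaleR)
  finally have eq: "transpose G *v \<eta> = e - u" "p None + \<eta> \<bullet> h = \<sigma> - u \<bullet> \<omega>0"
    using z(2) by simp_all
  have "u = e - transpose G *v \<eta>" unfolding eq(1) by simp
  moreover have "p None \<ge> 0" "\<eta> \<ge> 0" using p(1) by (auto simp: \<eta>_def less_eq_vec_def)
  ultimately show ?thesis using that[of \<eta>] z(3) eq(2) by simp
qed

section \<open>Integrals over the ambiguity set\<close>

lemma sets_empirical: "sets (empirical \<omega>h) = sets borel"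
  by (simp add: empirical_def sets.sigma_sets_eq[of borel, simplified])

text \<open>The uniform distribution on the indices accounts for coinciding samples, and integrals
  become finite averages.\<close>

lemma empirical_eq_distr:
  fixes \<omega>h :: "'n::finite \<Rightarrow> 'a::euclidean_space"
  shows "empirical \<omega>h = distr (measure_pmf (pmf_of_set UNIV)) borel \<omega>h"
proof (rule measure_eqI)
  show "sets (empirical \<omega>h) = sets (distr (measure_pmf (pmf_of_set UNIV)) borel \<omega>h)"
    by (simp add: sets_empirical)
next
  fix B assume "B \<in> sets (empirical \<omega>h)"
  then have B: "B \<in> sets borel" by (simp add: sets_empirical)
  have "(\<Sum>i\<in>UNIV. emeasure (return borel (\<omega>h i)) B) = (\<Sum>i\<in>UNIV. indicator (\<omega>h -` B) i)"
    using B by (intro sum.cong) (auto simp: indicator_def)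
  also have "\<dots> = ennreal (real (card (\<omega>h -` B)))"
    by (simp add: indicator_def vimage_def ennreal_of_nat_eq_real_of_nat)
  finally show "emeasure (empirical \<omega>h) B =
      emeasure (distr (measure_pmf (pmf_of_set UNIV)) borel \<omega>h) B"
    using B by (simp add: emeasure_empirical emeasure_distr emeasure_pmf_of_set ennreal_mult'[symmetric])
qed

lemma nn_integral_empirical:
  fixes \<omega>h :: "'n::finite \<Rightarrow> 'a::euclidean_space"
  assumes "f \<in> borel_measurable borel"
  shows "(\<integral>\<^sup>+\<omega>. f \<omega> \<partial>empirical \<omega>h) = (\<Sum>i\<in>UNIV. f (\<omega>h i)) / real CARD('n)"
  using assms by (simp add: empirical_eq_distr nn_integral_distr nn_integral_pmf_of_set
      ennreal_of_nat_eq_real_of_nat)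

text \<open>Weak transport duality: a pointwise bound by a function of the sample plus
  \<open>l\<close> times the distance is integrated against a coupling. The estimate runs in
  \<open>ennreal\<close>, so integrability of \<phi> need not be settled beforehand.\<close>

lemma ambiguity_set_integral_le:
  fixes \<omega>h :: "'n::finite \<Rightarrow> 'a::euclidean_space" and \<phi> :: "'a \<Rightarrow> real"
  assumes \<Omega>: "\<Omega> \<in> sets borel" and \<mu>: "\<mu> \<in> ambiguity_set \<Omega> \<theta> \<omega>h" and "0 \<le> \<theta>" "0 \<le> l"
    and \<phi>: "\<phi> \<in> borel_measurable borel" "\<And>\<omega>. 0 \<le> \<phi> \<omega>"
    and s: "\<And>i. 0 \<le> s i" "\<And>\<omega> i. \<omega> \<in> \<Omega> \<Longrightarrow> \<phi> \<omega> \<le> s i + l * norm (\<omega> - \<omega>h i)"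
  shows "(\<integral>\<omega>. \<phi> \<omega> \<partial>\<mu>) \<le> l * \<theta> + 1 / real CARD('n) * (\<Sum>i\<in>UNIV. s i)"
proof (rule field_le_epsilon)
  fix \<epsilon>' :: real assume "0 < \<epsilon>'"
  \<comment> \<open>The denominator \<open>l + 1\<close> also covers \<open>l = 0\<close>.\<close>
  define \<epsilon> where "\<epsilon> = \<epsilon>' / (l + 1)"
  have \<epsilon>: "0 < \<epsilon>" "l * \<epsilon> \<le> \<epsilon>'"
    using \<open>0 < \<epsilon>'\<close> \<open>0 \<le> l\<close> by (auto simp: \<epsilon>_def field_simps)
  have [measurable]: "\<Omega> \<in> sets borel" "\<phi> \<in> borel_measurable borel" by fact+
  have sets\<mu>: "sets \<mu> = sets borel" using \<mu> by (simp add: ambiguity_set_def prob_measures1_def)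
  define c where "c = (\<lambda>z :: 'a \<times> 'a. ennreal (norm (fst z - snd z)) * indicator (\<Omega> \<times> \<Omega>) z)"
  have [measurable]: "c \<in> borel_measurable (borel \<Otimes>\<^sub>M borel)" unfolding c_def by measurable
  \<comment> \<open>Attainment of the Wasserstein infimum is not presupposed; the slack \<epsilon>
    supplies a nearly optimal coupling.\<close>
  have "wasserstein1 \<Omega> \<mu> (empirical \<omega>h) \<le> ennreal \<theta>" using \<mu> by (simp add: ambiguity_set_def)
  also have "\<dots> < ennreal (\<theta> + \<epsilon>)" using \<epsilon> \<open>0 \<le> \<theta>\<close> by (simp add: ennreal_lessI)
  finally obtain \<gamma> where \<gamma>: "\<gamma> \<in> couplings \<Omega> \<mu> (empirical \<omega>h)" "(\<integral>\<^sup>+z. c z \<partial>\<gamma>) < ennreal (\<theta> + \<epsilon>)"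
    unfolding wasserstein1_def INF_less_iff c_def by auto
  have sets\<gamma>[measurable_cong]: "sets \<gamma> = sets (borel \<Otimes>\<^sub>M borel)"
    and ae: "AE z in \<gamma>. z \<in> \<Omega> \<times> \<Omega>"
    and marg: "\<mu> = distr \<gamma> borel fst" "empirical \<omega>h = distr \<gamma> borel snd"
    using \<gamma>(1) by (auto simp: couplings_def)
  \<comment> \<open>A continuous function with \<open>S (\<omega>h i) \<le> s i\<close>; \<open>s\<close> itself is no
    function of the sample point if samples coincide.\<close>
  define S where "S = (\<lambda>\<omega>'. INF i. ennreal (s i + l * norm (\<omega>' - \<omega>h i)))"
  have [measurable]: "S \<in> borel_measurable borel" unfolding S_def by measurable
  have S_le: "S (\<omega>h i) \<le> ennreal (s i)" for i
    unfolding S_def by (rule INF_lower2[of i]) auto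
  \<comment> \<open>The infimum over the finite index type is attained at some \<open>i\<close>; the
    triangle inequality then passes from \<open>\<omega>h i\<close> to \<omega>'.\<close>
  have bound: "ennreal (\<phi> \<omega>) \<le> S \<omega>' + ennreal l * ennreal (norm (\<omega> - \<omega>'))" if "\<omega> \<in> \<Omega>" for \<omega> \<omega>'
  proof -
    have "S \<omega>' \<in> range (\<lambda>i. ennreal (s i + l * norm (\<omega>' - \<omega>h i)))"
      unfolding S_def using Min_in[of "range (\<lambda>i. ennreal (s i + l * norm (\<omega>' - \<omega>h i)))"]
      by (simp add: cInf_eq_Min)
    then obtain i where i: "S \<omega>' = ennreal (s i + l * norm (\<omega>' - \<omega>h i))" by auto
    have "norm (\<omega> - \<omega>h i) \<le> norm (\<omega> - \<omega>') + norm (\<omega>' - \<omega>h i)"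
      using norm_triangle_ineq[of "\<omega> - \<omega>'" "\<omega>' - \<omega>h i"] by simp
    then have "l * norm (\<omega> - \<omega>h i) \<le> l * norm (\<omega> - \<omega>') + l * norm (\<omega>' - \<omega>h i)"
      using \<open>0 \<le> l\<close> by (metis mult_left_mono distrib_left)
    with s(2)[OF that, of i]
    have "\<phi> \<omega> \<le> (s i + l * norm (\<omega>' - \<omega>h i)) + l * norm (\<omega> - \<omega>')" by simp
    then have "ennreal (\<phi> \<omega>) \<le> ennreal ((s i + l * norm (\<omega>' - \<omega>h i)) + l * norm (\<omega> - \<omega>'))"
      by (rule ennreal_leI)
    then show ?thesis
      using \<open>0 \<le> l\<close> s(1)[of i] by (simp add: i ennreal_plus ennreal_mult)
  qed
  have "(\<integral>\<^sup>+\<omega>. ennreal (\<phi> \<omega>) \<partial>\<mu>) = (\<integral>\<^sup>+z. ennreal (\<phi> (fst z)) \<partial>\<gamma>)"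
    unfolding marg(1) by (subst nn_integral_distr) measurable
  also have "\<dots> \<le> (\<integral>\<^sup>+z. S (snd z) + ennreal l * c z \<partial>\<gamma>)"
    using ae by (intro nn_integral_mono_AE) (auto elim!: eventually_mono simp: c_def intro: bound)
  also have "\<dots> = (\<integral>\<^sup>+z. S (snd z) \<partial>\<gamma>) + ennreal l * (\<integral>\<^sup>+z. c z \<partial>\<gamma>)"
    by (subst nn_integral_add) (auto simp: nn_integral_cmult)
  also have "(\<integral>\<^sup>+z. S (snd z) \<partial>\<gamma>) = (\<integral>\<^sup>+\<omega>. S \<omega> \<partial>empirical \<omega>h)"
    unfolding marg(2) by (subst nn_integral_distr) measurable
  also have "\<dots> = (\<Sum>i\<in>UNIV. S (\<omega>h i)) / real CARD('n)"
    by (rule nn_integral_empirical) measurable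
  also have "\<dots> \<le> (\<Sum>i\<in>UNIV. ennreal (s i)) / real CARD('n)"
    by (intro divide_right_mono_ennreal sum_mono S_le)
  also have "\<dots> = ennreal (1 / real CARD('n) * (\<Sum>i\<in>UNIV. s i))"
    using s(1) by (simp add: divide_ennreal sum_nonneg)
  also have "ennreal l * (\<integral>\<^sup>+z. c z \<partial>\<gamma>) \<le> ennreal l * ennreal (\<theta> + \<epsilon>)"
    using \<gamma>(2) by (intro mult_left_mono) auto
  also have "\<dots> = ennreal (l * (\<theta> + \<epsilon>))"
    using \<open>0 \<le> l\<close> by (simp add: ennreal_mult')
  finally have "(\<integral>\<^sup>+\<omega>. ennreal (\<phi> \<omega>) \<partial>\<mu>)
      \<le> ennreal (1 / real CARD('n) * (\<Sum>i\<in>UNIV. s i) + l * (\<theta> + \<epsilon>))"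
    using s(1) \<open>0 \<le> l\<close> \<open>0 \<le> \<theta>\<close> \<epsilon> by (simp add: ennreal_plus sum_nonneg add_mono)
  moreover have "\<phi> \<in> borel_measurable \<mu>" using \<phi>(1) sets\<mu> by (simp cong: measurable_cong_sets)
  ultimately have "(\<integral>\<omega>. \<phi> \<omega> \<partial>\<mu>) \<le> 1 / real CARD('n) * (\<Sum>i\<in>UNIV. s i) + l * (\<theta> + \<epsilon>)"
    using s(1) \<open>0 \<le> l\<close> \<open>0 \<le> \<theta>\<close> \<epsilon> \<phi>(2)
    by (subst integral_eq_nn_integral)
      (auto intro!: enn2real_leI add_nonneg_nonneg divide_nonneg_nonneg sum_nonneg)
  then show "(\<integral>\<omega>. \<phi> \<omega> \<partial>\<mu>) \<le> l * \<theta> + 1 / real CARD('n) * (\<Sum>i\<in>UNIV. s i) + \<epsilon>'"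
    using \<epsilon>(2) by (simp add: algebra_simps)
qed

section \<open>Discrete measures in the ambiguity set\<close>

lemma pmf_of_finite_weights:
  assumes "finite J" "\<And>j. j \<in> J \<Longrightarrow> 0 \<le> p j" "(\<Sum>j\<in>J. p j) = (1::real)"
  obtains m where "set_pmf m \<subseteq> J" "\<And>j. j \<in> J \<Longrightarrow> pmf m j = p j"
proof -
  define q where "q = (\<lambda>j. if j \<in> J then p j else 0)"
  have q: "\<And>j. 0 \<le> q j" using assms(2) by (simp add: q_def)
  have "(\<integral>\<^sup>+j. ennreal (q j) \<partial>count_space UNIV) = (\<Sum>j\<in>J. ennreal (q j))"
    by (rule nn_integral_count_space'[OF assms(1)]) (auto simp: q_def)
  also have "\<dots> = 1" using assms q by (simp add: q_def)
  finally have *: "(\<integral>\<^sup>+j. ennreal (q j) \<partial>count_space UNIV) = 1" .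
  show ?thesis
    using set_embed_pmf[of q, OF q *] pmf_embed_pmf[of q, OF q *]
    by (intro that[of "embed_pmf q"]) (auto simp only: q_def split: if_splits)
qed

text \<open>The weights \<open>p\<close> move mass from the sample
  \<open>\<omega>h (\<kappa> j)\<close> to the point \<open>\<xi> j\<close>. The joint law of these
  two is an explicit coupling with the cost bounded in \<open>cost\<close>, while
  \<open>marg\<close> makes \<kappa> uniform on the sample indices.\<close>

lemma discrete_in_ambiguity_set:
  fixes \<omega>h :: "'n::finite \<Rightarrow> 'a::euclidean_space" and \<kappa> :: "'j \<Rightarrow> 'n" and \<xi> :: "'j \<Rightarrow> 'a"
  assumes \<Omega>: "\<Omega> \<in> sets borel" and "\<And>i. \<omega>h i \<in> \<Omega>" and "\<And>j. j \<in> J \<Longrightarrow> \<xi> j \<in> \<Omega>"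
    and J: "finite J" "\<And>j. j \<in> J \<Longrightarrow> 0 \<le> p j"
    and marg: "\<And>i. (\<Sum>j\<in>J. if \<kappa> j = i then p j else 0) = 1 / real CARD('n)"
    and cost: "(\<Sum>j\<in>J. p j * norm (\<xi> j - \<omega>h (\<kappa> j))) \<le> \<theta>"
  obtains P where "P \<in> ambiguity_set \<Omega> \<theta> \<omega>h"
    "\<And>f :: 'a \<Rightarrow> real. f \<in> borel_measurable borel \<Longrightarrow> (\<integral>\<omega>. f \<omega> \<partial>P) = (\<Sum>j\<in>J. p j * f (\<xi> j))"
proof -
  have "(\<Sum>j\<in>J. p j) = (\<Sum>j\<in>J. \<Sum>i\<in>UNIV. if \<kappa> j = i then p j else 0)" by simp
  also have "\<dots> = (\<Sum>i\<in>(UNIV::'n set). 1 / real CARD('n))"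
    by (subst sum.swap) (simp only: marg)
  also have "\<dots> = 1" by simp
  finally obtain m where m: "set_pmf m \<subseteq> J" "\<And>j. j \<in> J \<Longrightarrow> pmf m j = p j"
    using pmf_of_finite_weights J by metis
  have fin: "finite (set_pmf m)" using m(1) J(1) finite_subset by blast
  have int: "(\<integral>j. g j \<partial>measure_pmf m) = (\<Sum>j\<in>J. p j * g j)" for g :: "'j \<Rightarrow> real"
    using m J by (subst integral_measure_pmf_real[of J]) (auto intro!: sum.cong)
  have [measurable]: "\<Omega> \<in> sets borel" by fact
  define P where "P = distr (measure_pmf m) borel \<xi>"
  define \<gamma> where "\<gamma> = distr (measure_pmf m) (borel \<Otimes>\<^sub>M borel) (\<lambda>j. (\<xi> j, \<omega>h (\<kappa> j)))"
  have sets\<gamma>: "sets \<gamma> = sets (borel \<Otimes>\<^sub>M borel)" by (simp add: \<gamma>_def)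
  have [measurable]: "(\<lambda>j. (\<xi> j, \<omega>h (\<kappa> j))) \<in> measure_pmf m \<rightarrow>\<^sub>M borel \<Otimes>\<^sub>M borel"
    by (rule measurable_Pair) simp_all
  have "map_pmf \<kappa> m = pmf_of_set UNIV"
  proof (rule pmf_eqI)
    fix i
    have "pmf (map_pmf \<kappa> m) i = (\<integral>j. indicator (\<kappa> -` {i}) j \<partial>measure_pmf m)"
      by (simp add: pmf_map)
    also have "\<dots> = (\<Sum>j\<in>J. if \<kappa> j = i then p j else 0)"
      unfolding int by (intro sum.cong) (auto simp: indicator_def)
    finally show "pmf (map_pmf \<kappa> m) i = pmf (pmf_of_set UNIV) i" by (simp add: marg)
  qed
  then have "empirical \<omega>h = distr (measure_pmf m) borel (\<lambda>j. \<omega>h (\<kappa> j))"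
    by (simp add: empirical_eq_distr map_pmf_rep_eq[symmetric] flip: \<open>map_pmf \<kappa> m = pmf_of_set UNIV\<close>)
      (simp add: map_pmf_rep_eq distr_distr o_def)
  moreover have "distr \<gamma> borel fst = distr (measure_pmf m) borel (fst \<circ> (\<lambda>j. (\<xi> j, \<omega>h (\<kappa> j))))"
    "distr \<gamma> borel snd = distr (measure_pmf m) borel (snd \<circ> (\<lambda>j. (\<xi> j, \<omega>h (\<kappa> j))))"
    unfolding \<gamma>_def by (rule distr_distr; measurable)+
  ultimately have \<gamma>_marg: "distr \<gamma> borel fst = P" "distr \<gamma> borel snd = empirical \<omega>h"
    by (simp_all add: P_def o_def)
  have "AE z in \<gamma>. z \<in> \<Omega> \<times> \<Omega>"
    unfolding \<gamma>_def using assms(2,3) m(1)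
    by (subst AE_distr_iff) (auto simp: AE_measure_pmf_iff space_pair_measure)
  moreover have "prob_space \<gamma>"
    unfolding \<gamma>_def by (rule measure_pmf.prob_space_distr) measurable
  ultimately have "\<gamma> \<in> couplings \<Omega> P (empirical \<omega>h)"
    using \<gamma>_marg by (simp add: couplings_def sets\<gamma>)
  then have "wasserstein1 \<Omega> P (empirical \<omega>h) \<le>
      (\<integral>\<^sup>+z\<in>(\<Omega> \<times> \<Omega>). ennreal (norm (fst z - snd z)) \<partial>\<gamma>)"
    unfolding wasserstein1_def by (rule INF_lower)
  also have "\<dots> \<le> (\<integral>\<^sup>+z. ennreal (norm (fst z - snd z)) \<partial>\<gamma>)"
    by (intro nn_integral_mono) (auto simp: indicator_def)
  also have "\<dots> = (\<integral>\<^sup>+j. ennreal (norm (\<xi> j - \<omega>h (\<kappa> j))) \<partial>measure_pmf m)"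
    unfolding \<gamma>_def by (subst nn_integral_distr) (auto simp: space_pair_measure)
  also have "\<dots> = ennreal (\<Sum>j\<in>J. p j * norm (\<xi> j - \<omega>h (\<kappa> j)))"
    using fin by (subst nn_integral_eq_integral) (auto simp: int integrable_measure_pmf_finite)
  also have "\<dots> \<le> ennreal \<theta>" using cost by (rule ennreal_leI)
  finally have "P \<in> ambiguity_set \<Omega> \<theta> \<omega>h"
    using assms m fin unfolding ambiguity_set_def prob_measures1_def P_def
    by (auto simp: AE_distr_iff AE_measure_pmf_iff measure_pmf.prob_space_distr
        integrable_distr_eq integrable_measure_pmf_finite)
  moreover have "(\<integral>\<omega>. f \<omega> \<partial>P) = (\<Sum>j\<in>J. p j * f (\<xi> j))" if "f \<in> borel_measurable borel"
    for f :: "'a \<Rightarrow> real"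
    using that unfolding P_def by (subst integral_distr) (auto simp: int)
  ultimately show ?thesis by (rule that)
qed

section \<open>Duality for the worst-case CVaR\<close>

text \<open>
  In the index type of the linear system below, \<open>None\<close> stands for the zero branch of the positive
  part, on which neither \<open>L\<close> nor \<open>t\<close> appears.
\<close>

lemma cvar_ambiguity_set_dual:
  fixes \<omega>h :: "'n::finite \<Rightarrow> 'a::euclidean_space" and L :: "'k::finite \<Rightarrow> 'a \<Rightarrow> real"
  assumes \<alpha>: "0 < \<alpha>" "\<alpha> < 1" and \<theta>: "0 < \<theta>"
    and \<Omega>: "\<Omega> \<in> sets borel" "\<And>i. \<omega>h i \<in> \<Omega>" and L: "\<And>k. L k \<in> borel_measurable borel"
    and cvar: "(SUP P\<in>ambiguity_set \<Omega> \<theta> \<omega>h. cvar_inf \<alpha> P (\<lambda>\<omega>. Max (range (\<lambda>k. L k \<omega>)))) \<le> 0"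
  shows "\<exists>l t (s :: real^'n). 0 \<le> l \<and> (\<forall>i. 0 \<le> s $ i) \<and>
    l * \<theta> + 1 / real CARD('n) * (\<Sum>i\<in>UNIV. s $ i) \<le> t * \<alpha> \<and>
    (\<forall>i k. \<forall>\<omega>\<in>\<Omega>. L k \<omega> + t \<le> s $ i + l * norm (\<omega> - \<omega>h i))"
proof -
  define N where "N = real CARD('n)"
  have "N > 0" by (simp add: N_def)
  define \<tau> where "\<tau> = (\<lambda>c :: 'k option. case c of None \<Rightarrow> 0 :: real | Some _ \<Rightarrow> 1)"
  define \<beta> where "\<beta> = (\<lambda>(i :: 'n, c, \<omega>). case c of None \<Rightarrow> 0 | Some k \<Rightarrow> L k \<omega>)"
  \<comment> \<open>Coefficients of \<open>(l, t, s)\<close> in the constraint that bounds branch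
    \<open>c\<close> at \<omega> by
    \<open>s $ i + l * norm (\<omega> - \<omega>h i)\<close>.\<close>
  define u where "u = (\<lambda>(i, c, \<omega>). (norm (\<omega> - \<omega>h i), - \<tau> c, axis i (1::real)))"
  \<comment> \<open>\<open>Inr True\<close> is the budget constraint and \<open>Inr False\<close> is
    \<open>0 \<le> l\<close>; nonnegativity of \<open>s $ i\<close> is the \<open>None\<close>
    branch at \<open>\<omega>h i\<close>.\<close>
  define a where "a = (\<lambda>j. case j of Inl z \<Rightarrow> u z
      | Inr True \<Rightarrow> (- \<theta>, \<alpha>, \<chi> i. - 1 / N) | Inr False \<Rightarrow> (1, 0, 0))"
  define b where "b = (\<lambda>j. case j of Inl z \<Rightarrow> \<beta> z | Inr (_ :: bool) \<Rightarrow> 0)"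
  define I where "I = ((UNIV :: 'n set) \<times> (UNIV :: 'k option set) \<times> \<Omega>) <+> (UNIV :: bool set)"
  define I0 where "I0 = range (\<lambda>(i, c :: 'k option). (i, c, \<omega>h i)) <+> (UNIV :: bool set)"
  have I0: "finite I0" "I0 \<subseteq> I" using \<Omega>(2) by (auto simp: I0_def I_def)
  have I_mem: "Inr x \<in> I" "Inl (i, c, \<omega>) \<in> I \<longleftrightarrow> \<omega> \<in> \<Omega>" for x i c \<omega>
    by (auto simp: I_def)
  have I0_mem: "Inr x \<in> I0" "Inl (i, c, \<omega>h i) \<in> I0" for x i c
    by (auto simp: I0_def)
  have a_simps: "a (Inl (i, c, \<omega>)) \<bullet> (l, t, s) = norm (\<omega> - \<omega>h i) * l - \<tau> c * t + s $ i"
    "a (Inr True) \<bullet> (l, t, s) = \<alpha> * t - \<theta> * l - 1 / N * (\<Sum>i\<in>UNIV. s $ i)"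
    "a (Inr False) \<bullet> (l, t, s) = l" for i c \<omega> l t s
    by (simp_all add: a_def u_def inner_axis' inner_vec_def[of "vec_lambda _"]
        sum_negf sum_divide_distrib)
  have "\<exists>y. \<forall>j\<in>I. b j \<le> a j \<bullet> y"
  proof (rule ccontr)
    assume infeas: "\<not> (\<exists>y. \<forall>j\<in>I. b j \<le> a j \<bullet> y)"
    obtain k0 :: 'k where True by simp
    \<comment> \<open>Averaging the \<open>k0\<close> constraints over the samples and inserting the
      budget bounds \<open>t * (1 - \<alpha>)\<close>, which uses \<alpha> < 1. The budget then
      bounds \<open>\<theta> * l\<close> and the average of \<open>s\<close> by
      \<open>\<alpha> * t\<close>, hence by \<open>M\<close>.\<close>
    define M where "M = (\<Sum>i\<in>UNIV. \<bar>L k0 (\<omega>h i)\<bar>) / (1 - \<alpha>)"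
    have "{y. \<forall>j\<in>I0. b j \<le> a j \<bullet> y} \<subseteq>
        {0..M / \<theta>} \<times> {0..M} \<times> cbox 0 (\<chi> i. N * M)"
    proof
      fix y assume y: "y \<in> {y. \<forall>j\<in>I0. b j \<le> a j \<bullet> y}"
      obtain l t s where lts: "y = (l, t, s)" by (cases y)
      have le: "b j \<le> a j \<bullet> (l, t, s)" if "j \<in> I0" for j using y that lts by auto
      have "0 \<le> l" using le[of "Inr False"] by (simp add: a_simps b_def I0_mem)
      have budget: "\<theta> * l + 1 / N * (\<Sum>i\<in>UNIV. s $ i) \<le> \<alpha> * t"
        using le[of "Inr True"] by (simp add: a_simps b_def I0_mem)
      have s0: "0 \<le> s $ i" for i
        using le[of "Inl (i, None, \<omega>h i)"] by (simp add: a_simps b_def \<beta>_def \<tau>_def I0_mem)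
      have "L k0 (\<omega>h i) \<le> s $ i - t" for i
        using le[of "Inl (i, Some k0, \<omega>h i)"] by (simp add: a_simps b_def \<beta>_def \<tau>_def I0_mem)
      moreover have "- (\<Sum>i\<in>UNIV. \<bar>L k0 (\<omega>h i)\<bar>) \<le> L k0 (\<omega>h i)" for i
        using member_le_sum[of i UNIV "\<lambda>i. \<bar>L k0 (\<omega>h i)\<bar>"] by simp
      ultimately have "t - (\<Sum>i\<in>UNIV. \<bar>L k0 (\<omega>h i)\<bar>) \<le> s $ i" for i
        by (smt (verit))
      then have "(\<Sum>i\<in>(UNIV::'n set). t - (\<Sum>i\<in>UNIV. \<bar>L k0 (\<omega>h i)\<bar>)) \<le> (\<Sum>i\<in>UNIV. s $ i)"
        by (intro sum_mono)
      then have "t - (\<Sum>i\<in>UNIV. \<bar>L k0 (\<omega>h i)\<bar>) \<le> 1 / N * (\<Sum>i\<in>UNIV. s $ i)"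
        using \<open>N > 0\<close> by (simp add: N_def pos_le_divide_eq mult.commute)
      moreover have "0 \<le> \<theta> * l" using \<open>0 \<le> l\<close> \<theta> by simp
      ultimately have "t * (1 - \<alpha>) \<le> (\<Sum>i\<in>UNIV. \<bar>L k0 (\<omega>h i)\<bar>)"
        using budget by (simp add: algebra_simps)
      then have "t \<le> M" using \<alpha> by (simp add: M_def pos_le_divide_eq)
      have avg: "0 \<le> 1 / N * (\<Sum>i\<in>UNIV. s $ i)" using s0 \<open>N > 0\<close> by (simp add: sum_nonneg)
      have "0 \<le> \<alpha> * t" using budget avg \<open>0 \<le> \<theta> * l\<close> by linarith
      then have "0 \<le> t" using \<alpha> by (simp add: zero_le_mult_iff)
      have "\<alpha> * t \<le> M" using mult_left_le_one_le[of t \<alpha>] \<open>0 \<le> t\<close> \<open>t \<le> M\<close> \<alpha> by linarith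
      have "\<theta> * l \<le> M" using budget avg \<open>\<alpha> * t \<le> M\<close> by linarith
      then have "l \<le> M / \<theta>" using \<theta> by (simp add: pos_le_divide_eq mult.commute)
      have "1 / N * (\<Sum>i\<in>UNIV. s $ i) \<le> M"
        using budget \<open>\<alpha> * t \<le> M\<close> \<open>0 \<le> \<theta> * l\<close> by linarith
      then have "(\<Sum>i\<in>UNIV. s $ i) \<le> N * M"
        using \<open>N > 0\<close> by (simp add: pos_divide_le_eq mult.commute)
      moreover have "s $ i \<le> (\<Sum>i\<in>UNIV. s $ i)" for i
        using s0 by (intro member_le_sum) auto
      ultimately have "s $ i \<le> N * M" for i by (meson order_trans)
      with s0 have "s \<in> cbox 0 (\<chi> i. N * M)" by (simp add: mem_box_cart)
      with \<open>0 \<le> l\<close> \<open>l \<le> M / \<theta>\<close> \<open>0 \<le> t\<close> \<open>t \<le> M\<close>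
      show "y \<in> {0..M / \<theta>} \<times> {0..M} \<times> cbox 0 (\<chi> i. N * M)" by (simp add: lts)
    qed
    then have "bounded {y. \<forall>j\<in>I0. b j \<le> a j \<bullet> y}"
      by (rule bounded_subset[rotated]) (intro bounded_Times bounded_closed_interval bounded_cbox)
    then obtain J p where J: "finite J" "I0 \<subseteq> J" "J \<subseteq> I" and p: "\<forall>j\<in>J. 0 \<le> p j"
      and pa: "(\<Sum>j\<in>J. p j *\<^sub>R a j) = 0" and pb: "(\<Sum>j\<in>J. p j * b j) > 0"
      using farkas_bounded[OF infeas I0] by blast
    define J1 where "J1 = Inl -` J"
    \<comment> \<open>\<open>q\<close>, \<open>r\<close> and \<open>v\<close> are the multipliers of
      the pointwise constraints, of the budget and of \<open>0 \<le> l\<close>.\<close>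
    define q where "q = (\<lambda>z. p (Inl z))"
    define r where "r = p (Inr True)"
    define v where "v = p (Inr False)"
    have J1: "finite J1" unfolding J1_def using J(1) by (intro finite_vimageI) auto
    have J_eq: "J = J1 <+> UNIV"
    proof (rule set_eqI)
      show "j \<in> J \<longleftrightarrow> j \<in> J1 <+> UNIV" for j
        using J(2) I0_mem(1) by (cases j) (auto simp: J1_def)
    qed
    have \<xi>: "snd (snd z) \<in> \<Omega>" if "z \<in> J1" for z
      using that J(3) by (cases z) (auto simp: J1_def I_mem)
    have q: "\<And>z. z \<in> J1 \<Longrightarrow> 0 \<le> q z" and "r \<ge> 0" "v \<ge> 0"
      using p by (auto simp: J_eq q_def r_def v_def)
    have "(\<Sum>z\<in>J1. q z *\<^sub>R u z) + (v - r * \<theta>, r * \<alpha>, r *\<^sub>R (\<chi> i. - (1 / N))) = 0"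
      using pa J1 by (simp add: J_eq sum.Plus UNIV_bool a_def q_def r_def v_def o_def)
    \<comment> \<open>The three components are, up to the factor \<open>r\<close> and the sign of
      the second, the transport cost, the tail mass and the marginal on the samples.\<close>
    then have qu: "(\<Sum>z\<in>J1. q z *\<^sub>R u z) = (r * \<theta> - v, - (r * \<alpha>), \<chi> i. r / N)"
      by (simp add: eq_neg_iff_add_eq_0[symmetric] vec_eq_iff)
    have qb: "(\<Sum>z\<in>J1. q z * \<beta> z) > 0"
      using pb J1 by (simp add: J_eq sum.Plus b_def q_def o_def)
    have q_dist: "(\<Sum>z\<in>J1. q z * norm (snd (snd z) - \<omega>h (fst z))) = r * \<theta> - v"
      using arg_cong[OF qu, of fst] by (simp add: fst_sum u_def case_prod_beta)
    have q_\<tau>: "(\<Sum>z\<in>J1. q z * \<tau> (fst (snd z))) = r * \<alpha>"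
      using arg_cong[OF qu, of "\<lambda>y. fst (snd y)"]
      by (simp add: fst_sum snd_sum u_def case_prod_beta sum_negf)
    have q_marg: "(\<Sum>z\<in>J1. if fst z = i then q z else 0) = r / N" for i
      using arg_cong[OF qu, of "\<lambda>y. snd (snd y) $ i"]
      by (simp add: snd_sum u_def case_prod_beta axis_def if_distrib eq_commute[of i] cong: if_cong)
    \<comment> \<open>If \<open>r\<close> vanished, the coefficient of \<open>t\<close> would kill
      every multiplier on a \<open>Some\<close> branch; on the \<open>None\<close> branch \<beta> is
      0, so \<open>qb\<close> would fail.\<close>
    have "r > 0"
    proof (rule ccontr)
      assume "\<not> r > 0"
      then have "(\<Sum>z\<in>J1. q z * \<tau> (fst (snd z))) = 0" using q_\<tau> \<open>r \<ge> 0\<close> by simp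
      moreover have "0 \<le> q z * \<tau> (fst (snd z))" if "z \<in> J1" for z
        using q[OF that] by (simp add: \<tau>_def split: option.split)
      ultimately have zero: "\<forall>z\<in>J1. q z * \<tau> (fst (snd z)) = 0"
        using J1 by (simp add: sum_nonneg_eq_0_iff)
      have "q z * \<beta> z = 0" if "z \<in> J1" for z
        using zero that by (auto simp: \<tau>_def \<beta>_def split: option.splits prod.splits)
      then have "(\<Sum>z\<in>J1. q z * \<beta> z) = 0" by (rule sum.neutral[OF ballI])
      then show False using qb by simp
    qed
    have marg: "(\<Sum>z\<in>J1. if fst z = i then q z / r else 0) = 1 / real CARD('n)" for i
    proof -
      have "(\<Sum>z\<in>J1. if fst z = i then q z / r else 0) = (\<Sum>z\<in>J1. if fst z = i then q z else 0) / r"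
        unfolding sum_divide_distrib by (intro sum.cong) auto
      then show ?thesis using \<open>r > 0\<close> by (simp add: q_marg N_def)
    qed
    have "(\<Sum>z\<in>J1. q z / r * norm (snd (snd z) - \<omega>h (fst z))) = (r * \<theta> - v) / r"
      by (simp add: sum_divide_distrib q_dist[symmetric])
    also have "\<dots> \<le> \<theta>" using \<open>r > 0\<close> \<open>v \<ge> 0\<close> by (simp add: field_simps)
    finally have cost: "(\<Sum>z\<in>J1. q z / r * norm (snd (snd z) - \<omega>h (fst z))) \<le> \<theta>" .
    have qr: "\<And>z. z \<in> J1 \<Longrightarrow> 0 \<le> q z / r" using q \<open>r > 0\<close> by simp
    define Z where "Z = (\<lambda>\<omega>. Max (range (\<lambda>k. L k \<omega>)))"
    have [measurable]: "Z \<in> borel_measurable borel"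
      unfolding Z_def using L by (intro borel_measurable_Max) auto
    obtain P where P: "P \<in> ambiguity_set \<Omega> \<theta> \<omega>h"
      and intP: "\<And>g :: 'a \<Rightarrow> real. g \<in> borel_measurable borel \<Longrightarrow>
        (\<integral>\<omega>. g \<omega> \<partial>P) = (\<Sum>z\<in>J1. q z / r * g (snd (snd z)))"
      using discrete_in_ambiguity_set[OF \<Omega> \<xi> J1 qr marg cost] by blast
    \<comment> \<open>The weights \<open>q z / (r * \<alpha>)\<close> on the \<open>Some\<close>
      branches sum to 1 by \<open>q_\<tau>\<close>, and \<open>B\<close> is the mean of the
      corresponding values of \<open>L\<close>: a lower bound for the CVaR that does not involve
      \<open>t\<close>.\<close>
    define B where "B = (\<Sum>z\<in>J1. q z * \<beta> z) / (r * \<alpha>)"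
    have "B > 0" using qb \<open>r > 0\<close> \<alpha> by (simp add: B_def)
    have "B \<le> 1 / \<alpha> * (\<integral>\<omega>. max (Z \<omega> + t) 0 \<partial>P) - t" for t
    proof -
      \<comment> \<open>The positive part dominates both branches, so the branch recorded in
        \<open>z\<close> may be chosen freely at each point.\<close>
      have pt: "\<beta> z + \<tau> (fst (snd z)) * t \<le> max (Z (snd (snd z)) + t) 0" for z
      proof (cases "fst (snd z)")
        case None
        then show ?thesis by (simp add: \<beta>_def \<tau>_def case_prod_beta)
      next
        case (Some k)
        have "L k (snd (snd z)) \<le> Z (snd (snd z))" unfolding Z_def by (intro Max_ge) auto
        with Some show ?thesis by (simp add: \<beta>_def \<tau>_def case_prod_beta)
      qed
      have "(B + t) * \<alpha> = ((\<Sum>z\<in>J1. q z * \<beta> z) + t * (r * \<alpha>)) / r"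
        using \<open>r > 0\<close> \<alpha> by (simp add: B_def field_simps)
      also have "\<dots> = (\<Sum>z\<in>J1. q z / r * (\<beta> z + \<tau> (fst (snd z)) * t))"
        unfolding q_\<tau>[symmetric] sum_distrib_left sum.distrib[symmetric] sum_divide_distrib
        by (intro sum.cong refl) (simp add: distrib_left add_divide_distrib mult_ac)
      also have "\<dots> \<le> (\<Sum>z\<in>J1. q z / r * max (Z (snd (snd z)) + t) 0)"
        using qr pt by (intro sum_mono mult_left_mono)
      also have "\<dots> = (\<integral>\<omega>. max (Z \<omega> + t) 0 \<partial>P)" by (rule intP[symmetric]) measurable
      finally show ?thesis using \<alpha> by (simp add: pos_le_divide_eq le_diff_eq)
    qed
    then have "ereal B \<le> cvar_inf \<alpha> P Z" unfolding cvar_inf_def by (intro INF_greatest) simp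
    also have "\<dots> \<le> 0" using cvar P unfolding Z_def[symmetric] SUP_le_iff by blast
    finally show False using \<open>B > 0\<close> by simp
  qed
  then obtain l t s where y: "\<forall>j\<in>I. b j \<le> a j \<bullet> (l, t, s)" by auto
  show ?thesis
  proof (intro exI conjI allI ballI)
    show "0 \<le> l" using y[rule_format, of "Inr False"] by (simp add: a_simps b_def I_mem)
    show "0 \<le> s $ i" for i
      using y[rule_format, of "Inl (i, None, \<omega>h i)"] \<Omega>(2)
      by (simp add: a_simps b_def \<beta>_def \<tau>_def I_mem)
    show "l * \<theta> + 1 / real CARD('n) * (\<Sum>i\<in>UNIV. s $ i) \<le> t * \<alpha>"
      using y[rule_format, of "Inr True"] by (simp add: a_simps b_def I_mem N_def mult.commute)
    show "L k \<omega> + t \<le> s $ i + l * norm (\<omega> - \<omega>h i)" if "\<omega> \<in> \<Omega>" for i k \<omega>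
      using y[rule_format, of "Inl (i, Some k, \<omega>)"] that
      by (simp add: a_simps b_def \<beta>_def \<tau>_def I_mem mult.commute)
  qed
qed

section \<open>Equivalence of the two programs\<close>

lemma closed_polyhedron_le: "closed (polyhedron_le G h)"
  unfolding polyhedron_le_def less_eq_vec_def matrix_vector_mult_row_nth
  by (intro closed_Collect_all closed_Collect_le continuous_intros)

text \<open>At the index attaining the maximum, \<open>e k\<close> splits into \<open>w\<close> and
  \<open>transpose G *v \<eta> i k\<close>. Cauchy-Schwarz controls the first part along
  \<open>\<omega> - \<omega>h i\<close>; nonnegative multipliers applied to the inequalities of the
  polyhedron control the second.\<close>

lemma fin_feasible_imp_excess_le:
  fixes \<omega>h :: "'n::finite \<Rightarrow> real^'w" and d :: "'k::finite \<Rightarrow> real^'x"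
  assumes feas: "(x, l, t, s, \<eta>) \<in> fin_feasible A b d e f G h \<alpha> \<theta> \<omega>h"
    and \<omega>: "\<omega> \<in> polyhedron_le G h"
  shows "max (Zmax d e f x \<omega> + t) 0 \<le> s $ i + l * norm (\<omega> - \<omega>h i)"
proof -
  have "Zmax d e f x \<omega> \<in> range (\<lambda>k. d k \<bullet> x + e k \<bullet> \<omega> - f k)"
    unfolding Zmax_def by (intro Max_in) auto
  then obtain k where k: "Zmax d e f x \<omega> = d k \<bullet> x + e k \<bullet> \<omega> - f k" by auto
  define w where "w = e k - transpose G *v \<eta> i k"
  have s: "d k \<bullet> x - f k + t + w \<bullet> \<omega>h i + \<eta> i k \<bullet> h \<le> s $ i" "norm w \<le> l" "\<eta> i k \<ge> 0"
    "0 \<le> s $ i" "0 \<le> l"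
    using feas unfolding fin_feasible_def w_def by auto
  have "w \<bullet> (\<omega> - \<omega>h i) \<le> norm w * norm (\<omega> - \<omega>h i)" by (rule norm_cauchy_schwarz)
  also have "\<dots> \<le> l * norm (\<omega> - \<omega>h i)" using s(2) by (intro mult_right_mono) auto
  finally have 1: "w \<bullet> (\<omega> - \<omega>h i) \<le> l * norm (\<omega> - \<omega>h i)" .
  have "\<eta> i k \<bullet> (G *v \<omega>) \<le> \<eta> i k \<bullet> h"
    using s(3) \<omega> unfolding polyhedron_le_def inner_vec_def
    by (auto simp: less_eq_vec_def intro!: sum_mono mult_left_mono)
  then have 2: "(transpose G *v \<eta> i k) \<bullet> \<omega> \<le> \<eta> i k \<bullet> h"
    by (simp add: dot_lmul_matrix)
  have "e k \<bullet> \<omega> = w \<bullet> \<omega>h i + w \<bullet> (\<omega> - \<omega>h i) + (transpose G *v \<eta> i k) \<bullet> \<omega>"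
    by (simp add: w_def inner_diff_left inner_diff_right)
  with 1 2 s show ?thesis by (simp add: k)
qed

theorem mainTheorem1:
  fixes \<alpha> \<theta> :: real
    and c :: "real^'x" and A :: "real^'x^'m" and b :: "real^'m"
    and d :: "'k::finite \<Rightarrow> real^'x" and e :: "'k \<Rightarrow> real^'w" and f :: "'k \<Rightarrow> real"
    and G :: "real^'w^'r" and h :: "real^'r"
    and \<omega>h :: "'n::finite \<Rightarrow> real^'w"
  assumes "0 < \<alpha>" and "\<alpha> < 1" and "0 < \<theta>"
    and "\<And>i. \<omega>h i \<in> polyhedron_le G h"
  shows "(\<forall>x l t s (\<eta> :: 'n \<Rightarrow> 'k \<Rightarrow> real^'r).
            fin_objective c (x, l, t, s :: real^'n, \<eta>) = dr_objective c x) \<and>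
         (\<forall>x. x \<in> dr_feasible A b d e f G h \<alpha> \<theta> \<omega>h \<longleftrightarrow>
            (\<exists>l t s \<eta>. (x, l, t, s, \<eta>) \<in> fin_feasible A b d e f G h \<alpha> \<theta> \<omega>h))"
proof (intro conjI allI iffI)
  show "fin_objective c (x, l, t, s :: real^'n, \<eta>) = dr_objective c x"
    for x l t s and \<eta> :: "'n \<Rightarrow> 'k \<Rightarrow> real^'r"
    by (simp add: fin_objective_def dr_objective_def)
next
  fix x assume x: "x \<in> dr_feasible A b d e f G h \<alpha> \<theta> \<omega>h"
  let ?\<Omega> = "polyhedron_le G h"
  have meas: "(\<lambda>\<omega>. d k \<bullet> x + e k \<bullet> \<omega> - f k) \<in> borel_measurable borel" for k by measurable
  have "(SUP P\<in>ambiguity_set ?\<Omega> \<theta> \<omega>h.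
      cvar_inf \<alpha> P (\<lambda>\<omega>. Max (range (\<lambda>k. d k \<bullet> x + e k \<bullet> \<omega> - f k)))) \<le> 0"
    using x unfolding dr_feasible_def Zmax_def by (simp add: Zmax_def[abs_def])
  then obtain l t s where lts: "0 \<le> l" "\<And>i. 0 \<le> s $ i"
    "l * \<theta> + 1 / real CARD('n) * (\<Sum>i\<in>UNIV. s $ i) \<le> t * \<alpha>"
    and dom: "\<And>i k \<omega>. \<omega> \<in> ?\<Omega> \<Longrightarrow>
      (d k \<bullet> x + e k \<bullet> \<omega> - f k) + t \<le> s $ i + l * norm (\<omega> - \<omega>h i)"
    using cvar_ambiguity_set_dual[where \<omega>h = \<omega>h and L = "\<lambda>k \<omega>. d k \<bullet> x + e k \<bullet> \<omega> - f k",
        OF assms(1-3) borel_closed[OF closed_polyhedron_le] assms(4) meas]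
    by blast
  \<comment> \<open>For fixed \<open>l\<close>, \<open>t\<close> and \<open>s\<close>, the
    conditions on different pairs \<open>i\<close>, \<open>k\<close> do not interact, so the
    multipliers can be chosen separately.\<close>
  define Q where "Q = (\<lambda>i k \<eta>. \<eta> \<ge> 0 \<and> norm (e k - transpose G *v \<eta>) \<le> l \<and>
      (e k - transpose G *v \<eta>) \<bullet> \<omega>h i + \<eta> \<bullet> h \<le> s $ i - (d k \<bullet> x - f k + t))"
  have "\<exists>\<eta>. Q i k \<eta>" for i k
  proof -
    have "e k \<bullet> \<omega> - l * norm (\<omega> - \<omega>h i) \<le> s $ i - (d k \<bullet> x - f k + t)" if "\<omega> \<in> ?\<Omega>" for \<omega>
      using dom[OF that, of k i] by simp
    from norm_regularized_polyhedron_duality[OF assms(4) lts(1) this] show ?thesis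
      unfolding Q_def by metis
  qed
  then obtain \<eta> where "\<And>i k. Q i k (\<eta> i k)" by metis
  then have \<eta>: "\<eta> i k \<ge> 0 \<and> norm (e k - transpose G *v \<eta> i k) \<le> l \<and>
      (e k - transpose G *v \<eta> i k) \<bullet> \<omega>h i + \<eta> i k \<bullet> h \<le> s $ i - (d k \<bullet> x - f k + t)" for i k
    unfolding Q_def by blast
  have "d k \<bullet> x - f k + t + (e k - transpose G *v \<eta> i k) \<bullet> \<omega>h i + \<eta> i k \<bullet> h \<le> s $ i" for i k
    using \<eta>[of i k] by linarith
  then have "(x, l, t, s, \<eta>) \<in> fin_feasible A b d e f G h \<alpha> \<theta> \<omega>h"
    using x lts \<eta> unfolding dr_feasible_def fin_feasible_def by blast
  then show "\<exists>l t s \<eta>. (x, l, t, s, \<eta>) \<in> fin_feasible A b d e f G h \<alpha> \<theta> \<omega>h" by blast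
next
  fix x assume "\<exists>l t s \<eta>. (x, l, t, s, \<eta>) \<in> fin_feasible A b d e f G h \<alpha> \<theta> \<omega>h"
  then obtain l t s \<eta> where feas: "(x, l, t, s, \<eta>) \<in> fin_feasible A b d e f G h \<alpha> \<theta> \<omega>h"
    by blast
  then have Ax: "A *v x \<le> b" and "0 \<le> l" "\<And>i. 0 \<le> s $ i"
    and budget: "l * \<theta> + 1 / real CARD('n) * (\<Sum>i\<in>UNIV. s $ i) \<le> t * \<alpha>"
    unfolding fin_feasible_def by auto
  have Z: "(\<lambda>\<omega>. max (Zmax d e f x \<omega> + t) 0) \<in> borel_measurable borel"
  proof -
    have [measurable]: "Zmax d e f x \<in> borel_measurable borel"
      unfolding Zmax_def[abs_def] by (intro borel_measurable_Max) auto
    show ?thesis by measurable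
  qed
  \<comment> \<open>The single \<open>t\<close> of the finite program serves every \<open>P\<close>,
    and the infimum is at most the value there.\<close>
  have "cvar_inf \<alpha> P (Zmax d e f x) \<le> 0"
    if P: "P \<in> ambiguity_set (polyhedron_le G h) \<theta> \<omega>h" for P
  proof -
    have "(\<integral>\<omega>. max (Zmax d e f x \<omega> + t) 0 \<partial>P) \<le> l * \<theta> + 1 / real CARD('n) * (\<Sum>i\<in>UNIV. s $ i)"
      using assms(3) \<open>0 \<le> l\<close> \<open>\<And>i. 0 \<le> s $ i\<close> Z fin_feasible_imp_excess_le[OF feas]
      by (intro ambiguity_set_integral_le[OF borel_closed[OF closed_polyhedron_le] P]) auto
    with budget have "(\<integral>\<omega>. max (Zmax d e f x \<omega> + t) 0 \<partial>P) \<le> t * \<alpha>" by linarith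
    then have "1 / \<alpha> * (\<integral>\<omega>. max (Zmax d e f x \<omega> + t) 0 \<partial>P) - t \<le> 0"
      using assms(1) by (simp add: pos_divide_le_eq)
    then show ?thesis unfolding cvar_inf_def
      by (intro INF_lower2[of t]) auto
  qed
  then show "x \<in> dr_feasible A b d e f G h \<alpha> \<theta> \<omega>h"
    using Ax by (auto simp: dr_feasible_def intro: SUP_least)
qed

end
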